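(* Let $n\in\{2,3\}$, let $A>0$, $\gamma\ge 1$, and let $\mu,\lambda$ be real constants with $\mu>0$ and $n\lambda+2\mu>0$. Let $\Omega\subseteq\mathbb{R}^n$ be a smooth bounded domain or $\Omega=\mathbb{R}^n$, let $I\subseteq[0,\infty)$ be a time interval, and let $(\rho,u)$, with $\rho:I\times\Omega\to[0,\infty)$ and $u:I\times\Omega\to\mathbb{R}^n$, be a solution on $I\times\Omega$ of the compressible Navier-Stokes equations $$\begin{cases}\partial_t\rho+\nabla\cdot(\rho u)=0,\\ \partial_t(\rho u)+\nabla\cdot(\rho u\otimes u)+\nabla P(\rho)=\mu\Delta u+(\lambda+\mu)\nabla(\nabla\cdot u),\\ P(\rho)=A\rho^\gamma.\end{cases}$$ For $\kappa>0$ define $$\rho^\kappa(t,x)=\kappa^{\frac1\gamma}\rho\big(\kappa t,\kappa^{\frac{\gamma+1}{2\gamma}}x\big),\qquad u^\kappa(t,x)=\kappa^{\frac{\gamma-1}{2\gamma}}u\big(\kappa t,\kappa^{\frac{\gamma+1}{2\gamma}}x\big).$$ Then for every $\kappa>0$, $(\rho^\kappa,u^\kappa)$ is also a solution of the same system (with the same constants $A,\gamma,\mu,\lambda$), on the rescaled space-time domain $\{(t,x):\ \kappa t\in I,\ \kappa^{\frac{\gamma+1}{2\gamma}}x\in\Omega\}$.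
   Context: "Solution" may be read either in the classical pointwise sense (all the derivatives appearing in the system exist and the equations hold pointwise) or in the sense of distributions; the same sense is used in the hypothesis and in the conclusion. *)

theory Defs
  imports "HOL-Analysis.Analysis"
begin

section \<open>Pointwise partial derivatives and the differential operators\<close>

definition partial_differentiable :: "'n::finite \<Rightarrow> (real^'n \<Rightarrow> real) \<Rightarrow> real^'n \<Rightarrow> bool" where
  "partial_differentiable i f x \<longleftrightarrow> (\<lambda>s::real. f (x + s *\<^sub>R axis i 1)) differentiable (at 0)"

text \<open>Only meaningful where \<^const>\<open>partial_differentiable\<close> holds (elsewhere an unspecified value);
  the same applies to the operators built from it.\<close>

definition partial :: "'n::finite \<Rightarrow> (real^'n \<Rightarrow> real) \<Rightarrow> real^'n \<Rightarrow> real" where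
  "partial i f x = deriv (\<lambda>s::real. f (x + s *\<^sub>R axis i 1)) 0"

definition grad :: "(real^'n \<Rightarrow> real) \<Rightarrow> real^'n \<Rightarrow> real^'n::finite" where
  "grad f x = (\<chi> i. partial i f x)"

definition divergence :: "(real^'n \<Rightarrow> real^'n) \<Rightarrow> real^'n::finite \<Rightarrow> real" where
  "divergence F x = (\<Sum>i\<in>UNIV. partial i (\<lambda>y. F y $ i) x)"

definition div_tensor :: "(real^'n \<Rightarrow> real^'n^'n) \<Rightarrow> real^'n::finite \<Rightarrow> real^'n" where
  "div_tensor T x = (\<chi> i. \<Sum>j\<in>UNIV. partial j (\<lambda>y. T y $ i $ j) x)"

definition vec_laplacian :: "(real^'n \<Rightarrow> real^'n) \<Rightarrow> real^'n::finite \<Rightarrow> real^'n" where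
  "vec_laplacian F x = (\<chi> i. \<Sum>j\<in>UNIV. partial j (partial j (\<lambda>y. F y $ i)) x)"

definition outer :: "real^'n \<Rightarrow> real^'n \<Rightarrow> real^'n^'n" where
  "outer v w = (\<chi> i j. v $ i * w $ j)"


section \<open>Smooth bounded domains\<close>

primrec C_k :: "nat \<Rightarrow> (real^'n::finite \<Rightarrow> real) \<Rightarrow> bool" where
  "C_k 0 f \<longleftrightarrow> continuous_on UNIV f"
| "C_k (Suc k) f \<longleftrightarrow> continuous_on UNIV f \<and>
     (\<forall>i. (\<forall>x. partial_differentiable i f x) \<and> C_k k (partial i f))"

definition C_infinity :: "(real^'n::finite \<Rightarrow> real) \<Rightarrow> bool" where
  "C_infinity f \<longleftrightarrow> (\<forall>k. C_k k f)"

text \<open>Near each of its points the boundary is the graph, over the remaining coordinates, of a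
  \<open>C\<^sup>\<infinity>\<close> function, with the set lying on one side of it. A function of the coordinates other
  than \<open>i\<close> is encoded as a function on the whole space that does not depend on coordinate \<open>i\<close>.\<close>

definition smooth_boundary :: "(real^'n::finite) set \<Rightarrow> bool" where
  "smooth_boundary \<Omega> \<longleftrightarrow>
     (\<forall>p\<in>frontier \<Omega>. \<exists>r>0. \<exists>i. \<exists>\<sigma>\<in>{-1, 1}. \<exists>g.
        C_infinity g \<and>
        (\<forall>x y. (\<forall>j. j \<noteq> i \<longrightarrow> x $ j = y $ j) \<longrightarrow> g x = g y) \<and>
        \<Omega> \<inter> ball p r = {x \<in> ball p r. \<sigma> * x $ i > g x})"

definition smooth_bounded_domain :: "(real^'n::finite) set \<Rightarrow> bool" where
  "smooth_bounded_domain \<Omega> \<longleftrightarrow>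
     open \<Omega> \<and> connected \<Omega> \<and> \<Omega> \<noteq> {} \<and> bounded \<Omega> \<and> smooth_boundary \<Omega>"


section \<open>Classical solutions of the compressible Navier--Stokes equations\<close>

definition pressure :: "real \<Rightarrow> real \<Rightarrow> real \<Rightarrow> real" where
  "pressure A \<gamma> r = A * r powr \<gamma>"

text \<open>The spatial derivatives occurring in the system exist at \<open>x\<close>, for the density \<open>r\<close> and the
  velocity \<open>v\<close> at a fixed time.\<close>

definition spatial_derivs_exist ::
    "real \<Rightarrow> real \<Rightarrow> (real^'n::finite \<Rightarrow> real) \<Rightarrow> (real^'n \<Rightarrow> real^'n) \<Rightarrow> real^'n \<Rightarrow> bool" where
  "spatial_derivs_exist A \<gamma> r v x \<longleftrightarrow>
     (\<forall>i. partial_differentiable i (\<lambda>y. (r y *\<^sub>R v y) $ i) x) \<and>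
     (\<forall>i j. partial_differentiable j (\<lambda>y. (r y *\<^sub>R outer (v y) (v y)) $ i $ j) x) \<and>
     (\<forall>i. partial_differentiable i (\<lambda>y. pressure A \<gamma> (r y)) x) \<and>
     (\<forall>i j. partial_differentiable j (\<lambda>y. v y $ i) x) \<and>
     (\<forall>i j. partial_differentiable j (partial j (\<lambda>y. v y $ i)) x) \<and>
     (\<forall>i. partial_differentiable i (divergence v) x)"

text \<open>\<open>D\<close> is the space-time domain; its time slices are meant to be open, so that the spatial
  derivatives depend only on the values in \<open>D\<close>. The time derivatives are taken within \<open>D\<close>, hence
  are one-sided at an endpoint of the time interval that belongs to it.\<close>

definition NS_solution ::
    "real \<Rightarrow> real \<Rightarrow> real \<Rightarrow> real \<Rightarrow> (real \<times> (real^'n::finite)) set \<Rightarrow>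
     (real \<Rightarrow> real^'n \<Rightarrow> real) \<Rightarrow> (real \<Rightarrow> real^'n \<Rightarrow> real^'n) \<Rightarrow> bool" where
  "NS_solution A \<gamma> \<mu> lam D \<rho> u \<longleftrightarrow>
     (\<forall>t x. (t, x) \<in> D \<longrightarrow>
        \<rho> t x \<ge> 0 \<and>
        spatial_derivs_exist A \<gamma> (\<rho> t) (u t) x \<and>
        (\<exists>\<rho>\<^sub>t. ((\<lambda>s. \<rho> s x) has_real_derivative \<rho>\<^sub>t) (at t within {s. (s, x) \<in> D}) \<and>
           \<rho>\<^sub>t + divergence (\<lambda>y. \<rho> t y *\<^sub>R u t y) x = 0) \<and>
        (\<exists>m\<^sub>t. ((\<lambda>s. \<rho> s x *\<^sub>R u s x) has_vector_derivative m\<^sub>t) (at t within {s. (s, x) \<in> D}) \<and>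
           m\<^sub>t + div_tensor (\<lambda>y. \<rho> t y *\<^sub>R outer (u t y) (u t y)) x
              + grad (\<lambda>y. pressure A \<gamma> (\<rho> t y)) x
           = \<mu> *\<^sub>R vec_laplacian (u t) x + (lam + \<mu>) *\<^sub>R grad (divergence (u t)) x))"

definition rescaled_density ::
    "real \<Rightarrow> real \<Rightarrow> (real \<Rightarrow> real^'n::finite \<Rightarrow> real) \<Rightarrow> real \<Rightarrow> real^'n \<Rightarrow> real" where
  "rescaled_density \<gamma> \<kappa> \<rho> t x =
     \<kappa> powr (1 / \<gamma>) * \<rho> (\<kappa> * t) (\<kappa> powr ((\<gamma> + 1) / (2 * \<gamma>)) *\<^sub>R x)"

definition rescaled_velocity ::
    "real \<Rightarrow> real \<Rightarrow> (real \<Rightarrow> real^'n::finite \<Rightarrow> real^'n) \<Rightarrow> real \<Rightarrow> real^'n \<Rightarrow> real^'n" where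
  "rescaled_velocity \<gamma> \<kappa> u t x =
     \<kappa> powr ((\<gamma> - 1) / (2 * \<gamma>)) *\<^sub>R u (\<kappa> * t) (\<kappa> powr ((\<gamma> + 1) / (2 * \<gamma>)) *\<^sub>R x)"

end

theory Submission
  imports Defs
begin

text \<open>
  The three factors \<open>a = \<kappa> powr ((\<gamma> + 1) / (2 * \<gamma>))\<close> (space), \<open>b = \<kappa> powr (1 / \<gamma>)\<close> (density) and
  \<open>c = \<kappa> powr ((\<gamma> - 1) / (2 * \<gamma>))\<close> (velocity) satisfy \<open>c * a = \<kappa>\<close>, \<open>b * c = a\<close> and
  \<open>b powr \<gamma> = \<kappa>\<close>. By the chain rule every term of the rescaled system at \<open>(t, x)\<close> is therefore a
  constant multiple of the same term of the original system at \<open>(\<kappa> * t, a *\<^sub>R x)\<close>, and the constant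
  depends only on the equation. In the continuity equation the factors are \<open>b * \<kappa>\<close> (time derivative)
  and \<open>b * c * a\<close> (flux), which agree. In the momentum equation they are \<open>b * c * \<kappa>\<close>
  (time derivative), \<open>b * c\<^sup>2 * a\<close> (convection), \<open>b powr \<gamma> * a\<close> (pressure) and \<open>c * a\<^sup>2\<close> (viscosity),
  and all of them equal \<open>a * \<kappa>\<close>.

  The second-order terms need care. A partial derivative is an unspecified value where it does not
  exist, so the first derivatives and the divergence of the velocity are known to scale only at points
  of the domain. The domain is open, however, and a partial derivative at a point of an open set is
  determined by the values on that set. The chain rule \<open>partial_rescale\<close> is therefore stated for
  functions related on an open set, and can be applied a second time to these quantities.
\<close>

section \<open>Spatial derivatives under dilation\<close>

lemma partial_rescale:
  fixes f g :: "real^'n::finite \<Rightarrow> real"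
  assumes "open S" and "a *\<^sub>R x \<in> S"
    and eq: "\<And>y. a *\<^sub>R y \<in> S \<Longrightarrow> g y = k * f (a *\<^sub>R y)"
    and f: "partial_differentiable i f (a *\<^sub>R x)"
  shows "partial_differentiable i g x" and "partial i g x = k * a * partial i f (a *\<^sub>R x)"
proof -
  have "((\<lambda>s. f (a *\<^sub>R x + s *\<^sub>R axis i 1)) has_real_derivative partial i f (a *\<^sub>R x)) (at (a * 0))"
    using f unfolding partial_differentiable_def partial_def
    by (simp add: DERIV_deriv_iff_real_differentiable)
  from DERIV_chain2[OF this DERIV_cmult_Id[of a 0 UNIV]]
  have scaled: "((\<lambda>s. k * f (a *\<^sub>R x + (a * s) *\<^sub>R axis i 1))
      has_real_derivative k * a * partial i f (a *\<^sub>R x)) (at 0)"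
    by (auto dest: DERIV_cmult[where c = k] simp: ac_simps)
  define l where "l s = a *\<^sub>R (x + s *\<^sub>R axis i (1::real))" for s
  have "isCont l 0"
    unfolding l_def by (intro continuous_intros)
  moreover have "l 0 \<in> S"
    using assms(2) by (simp add: l_def)
  ultimately have "eventually (\<lambda>s. l s \<in> S) (nhds 0)"
    using \<open>open S\<close> by (simp add: continuous_at_open eventually_nhds)
  then have "eventually (\<lambda>s. k * f (a *\<^sub>R x + (a * s) *\<^sub>R axis i 1) = g (x + s *\<^sub>R axis i 1)) (nhds 0)"
    by eventually_elim (simp add: l_def eq scaleR_add_right)
  with scaled have der: "((\<lambda>s. g (x + s *\<^sub>R axis i 1))
      has_real_derivative k * a * partial i f (a *\<^sub>R x)) (at 0)"
    by (subst (asm) DERIV_cong_ev[OF refl _ refl])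
  then show "partial_differentiable i g x"
    unfolding partial_differentiable_def real_differentiable_def by blast
  from der show "partial i g x = k * a * partial i f (a *\<^sub>R x)"
    unfolding partial_def by (rule DERIV_imp_deriv)
qed

lemma divergence_rescale:
  fixes F G :: "real^'n::finite \<Rightarrow> real^'n"
  assumes "open S" and "a *\<^sub>R x \<in> S"
    and "\<And>y. a *\<^sub>R y \<in> S \<Longrightarrow> G y = k *\<^sub>R F (a *\<^sub>R y)"
    and "\<And>i. partial_differentiable i (\<lambda>y. F y $ i) (a *\<^sub>R x)"
  shows "divergence G x = k * a * divergence F (a *\<^sub>R x)"
  unfolding divergence_def sum_distrib_left
  by (intro sum.cong refl partial_rescale(2)[OF assms(1,2) _ assms(4)]) (simp add: assms(3))

lemma grad_rescale:
  fixes f g :: "real^'n::finite \<Rightarrow> real"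
  assumes "open S" and "a *\<^sub>R x \<in> S"
    and "\<And>y. a *\<^sub>R y \<in> S \<Longrightarrow> g y = k * f (a *\<^sub>R y)"
    and "\<And>i. partial_differentiable i f (a *\<^sub>R x)"
  shows "grad g x = (k * a) *\<^sub>R grad f (a *\<^sub>R x)"
  using partial_rescale(2)[OF assms] by (simp add: grad_def vec_eq_iff)

lemma div_tensor_rescale:
  fixes T U :: "real^'n::finite \<Rightarrow> real^'n^'n"
  assumes "open S" and "a *\<^sub>R x \<in> S"
    and "\<And>y. a *\<^sub>R y \<in> S \<Longrightarrow> U y = k *\<^sub>R T (a *\<^sub>R y)"
    and "\<And>i j. partial_differentiable j (\<lambda>y. T y $ i $ j) (a *\<^sub>R x)"
  shows "div_tensor U x = (k * a) *\<^sub>R div_tensor T (a *\<^sub>R x)"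
proof -
  have "partial j (\<lambda>y. U y $ i $ j) x = k * a * partial j (\<lambda>y. T y $ i $ j) (a *\<^sub>R x)" for i j
    by (rule partial_rescale(2)[OF assms(1,2) _ assms(4)]) (simp add: assms(3))
  then show ?thesis
    by (simp add: div_tensor_def vec_eq_iff sum_distrib_left)
qed

text \<open>The first derivatives are needed on the whole of \<open>S\<close>: the second ones at \<open>x\<close> are obtained by
  applying the chain rule to the identity between the first ones near \<open>x\<close>.\<close>

lemma vec_laplacian_rescale:
  fixes F G :: "real^'n::finite \<Rightarrow> real^'n"
  assumes "open S" and "a *\<^sub>R x \<in> S"
    and "\<And>y. a *\<^sub>R y \<in> S \<Longrightarrow> G y = k *\<^sub>R F (a *\<^sub>R y)"
    and "\<And>z i j. z \<in> S \<Longrightarrow> partial_differentiable j (\<lambda>y. F y $ i) z"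
    and "\<And>i j. partial_differentiable j (partial j (\<lambda>y. F y $ i)) (a *\<^sub>R x)"
  shows "partial_differentiable j (partial j (\<lambda>y. G y $ i)) x"
    and "vec_laplacian G x = (k * a * a) *\<^sub>R vec_laplacian F (a *\<^sub>R x)"
proof -
  have first: "partial j (\<lambda>y. G y $ i) y = k * a * partial j (\<lambda>y. F y $ i) (a *\<^sub>R y)"
    if "a *\<^sub>R y \<in> S" for i j y
    by (rule partial_rescale(2)[OF assms(1) that _ assms(4)[OF that]]) (simp add: assms(3))
  note second = partial_rescale[OF assms(1,2) first assms(5)]
  show "partial_differentiable j (partial j (\<lambda>y. G y $ i)) x"
    by (rule second(1))
  show "vec_laplacian G x = (k * a * a) *\<^sub>R vec_laplacian F (a *\<^sub>R x)"
    by (simp add: vec_laplacian_def vec_eq_iff second(2) sum_distrib_left)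
qed

section \<open>Time derivatives under dilation\<close>

text \<open>The derivatives are taken within a set so that one-sided derivatives at an endpoint of the
  time interval are covered.\<close>

lemma has_vector_derivative_rescale:
  fixes f :: "real \<Rightarrow> 'a::real_normed_vector"
  assumes "(f has_vector_derivative d) (at (k * t) within J)"
  shows "((\<lambda>s. r *\<^sub>R f (k * s)) has_vector_derivative (r * k) *\<^sub>R d) (at t within {s. k * s \<in> J})"
proof -
  have "((\<lambda>s. k * s) has_vector_derivative k) (at t within {s. k * s \<in> J})"
    by (auto intro!: derivative_eq_intros)
  moreover have "(f has_vector_derivative d) (at (k * t) within (*) k ` {s. k * s \<in> J})"
    by (rule has_vector_derivative_within_subset[OF assms]) auto
  ultimately have "(f \<circ> (*) k has_vector_derivative k *\<^sub>R d) (at t within {s. k * s \<in> J})"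
    by (rule vector_diff_chain_within)
  then show ?thesis
    by (auto dest: has_vector_derivative_scaleR[OF DERIV_const[of r]] simp: o_def)
qed

section \<open>The compressible Navier--Stokes system\<close>

lemma pressure_mult: "pressure A \<gamma> (b * r) = b powr \<gamma> * pressure A \<gamma> r"
  by (simp add: pressure_def powr_mult)

text \<open>The factors are kept abstract: the powers of \<open>\<kappa>\<close> in the rescaling enter the argument only
  through the relations \<open>c * a = \<kappa>\<close>, \<open>b * c = a\<close> and \<open>b powr \<gamma> = \<kappa>\<close>, by which all terms of an
  equation acquire the same factor.\<close>

lemma NS_solution_rescale:
  fixes \<rho> :: "real \<Rightarrow> real^'n::finite \<Rightarrow> real" and u :: "real \<Rightarrow> real^'n \<Rightarrow> real^'n"
  assumes "open \<Omega>" and sol: "NS_solution A \<gamma> \<mu> lam (I \<times> \<Omega>) \<rho> u"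
    and "b \<ge> 0" and ca: "c * a = \<kappa>" and bc: "b * c = a" and b: "b powr \<gamma> = \<kappa>"
  shows "NS_solution A \<gamma> \<mu> lam {(t, x). \<kappa> * t \<in> I \<and> a *\<^sub>R x \<in> \<Omega>}
    (\<lambda>t x. b * \<rho> (\<kappa> * t) (a *\<^sub>R x)) (\<lambda>t x. c *\<^sub>R u (\<kappa> * t) (a *\<^sub>R x))"
  unfolding NS_solution_def
proof (intro allI impI)
  fix t x
  assume "(t, x) \<in> {(t, x). \<kappa> * t \<in> I \<and> a *\<^sub>R x \<in> \<Omega>}"
  then have t: "\<kappa> * t \<in> I" and x: "a *\<^sub>R x \<in> \<Omega>"
    by auto
  let ?r = "\<rho> (\<kappa> * t)" and ?v = "u (\<kappa> * t)"
  let ?R = "\<lambda>y. b * ?r (a *\<^sub>R y)" and ?V = "\<lambda>y. c *\<^sub>R ?v (a *\<^sub>R y)"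
  have nonneg: "?r z \<ge> 0" and derivs: "spatial_derivs_exist A \<gamma> ?r ?v z" if "z \<in> \<Omega>" for z
    using sol t that unfolding NS_solution_def by auto
  have flux: "partial_differentiable i (\<lambda>y. (?r y *\<^sub>R ?v y) $ i) z"
    and convection: "partial_differentiable j (\<lambda>y. (?r y *\<^sub>R outer (?v y) (?v y)) $ i $ j) z"
    and press: "partial_differentiable i (\<lambda>y. pressure A \<gamma> (?r y)) z"
    and vel: "partial_differentiable j (\<lambda>y. ?v y $ i) z"
    and vel2: "partial_differentiable j (partial j (\<lambda>y. ?v y $ i)) z"
    and divv: "partial_differentiable i (divergence ?v) z"
    if "z \<in> \<Omega>" for z i j
    using derivs[OF that] unfolding spatial_derivs_exist_def by blast+
  have flux_eq: "?R y *\<^sub>R ?V y = (b * c) *\<^sub>R (?r (a *\<^sub>R y) *\<^sub>R ?v (a *\<^sub>R y))" for y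
    by simp
  have convection_eq: "?R y *\<^sub>R outer (?V y) (?V y)
      = (b * c * c) *\<^sub>R (?r (a *\<^sub>R y) *\<^sub>R outer (?v (a *\<^sub>R y)) (?v (a *\<^sub>R y)))" for y
    by (simp add: outer_def vec_eq_iff)
  have press_eq: "pressure A \<gamma> (?R y) = \<kappa> * pressure A \<gamma> (?r (a *\<^sub>R y))" for y
    by (simp add: pressure_mult b)
  have div_eq: "divergence ?V y = \<kappa> * divergence ?v (a *\<^sub>R y)" if "a *\<^sub>R y \<in> \<Omega>" for y
    using divergence_rescale[OF \<open>open \<Omega>\<close> that refl vel[OF that]] by (simp add: ca)
  note rescale = partial_rescale(1)[OF \<open>open \<Omega>\<close> x]

  have "spatial_derivs_exist A \<gamma> ?R ?V x"
    unfolding spatial_derivs_exist_def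
  proof (intro conjI allI)
    fix i j
    show "partial_differentiable i (\<lambda>y. (?R y *\<^sub>R ?V y) $ i) x"
      by (rule rescale[OF _ flux[OF x], where k = "b * c"]) simp
    show "partial_differentiable j (\<lambda>y. (?R y *\<^sub>R outer (?V y) (?V y)) $ i $ j) x"
      by (rule rescale[OF _ convection[OF x, of j i], where k = "b * c * c"]) (simp add: outer_def)
    show "partial_differentiable i (\<lambda>y. pressure A \<gamma> (?R y)) x"
      by (rule rescale[OF press_eq press[OF x]])
    show "partial_differentiable j (\<lambda>y. ?V y $ i) x"
      by (rule rescale[OF _ vel[OF x, of j i], where k = c]) simp
    show "partial_differentiable j (partial j (\<lambda>y. ?V y $ i)) x"
      by (rule vec_laplacian_rescale(1)[OF \<open>open \<Omega>\<close> x refl vel vel2[OF x]])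
    show "partial_differentiable i (divergence ?V) x"
      by (rule rescale[OF div_eq divv[OF x]])
  qed
  moreover have "?R x \<ge> 0"
    using nonneg[OF x] \<open>b \<ge> 0\<close> by simp
  moreover have "\<exists>d. ((\<lambda>s. b * \<rho> (\<kappa> * s) (a *\<^sub>R x)) has_real_derivative d)
        (at t within {s. (s, x) \<in> {(t, x). \<kappa> * t \<in> I \<and> a *\<^sub>R x \<in> \<Omega>}}) \<and>
      d + divergence (\<lambda>y. ?R y *\<^sub>R ?V y) x = 0"
  proof -
    obtain d where "((\<lambda>s. \<rho> s (a *\<^sub>R x)) has_real_derivative d) (at (\<kappa> * t) within I)"
      and d: "d + divergence (\<lambda>y. ?r y *\<^sub>R ?v y) (a *\<^sub>R x) = 0"
      using sol t x unfolding NS_solution_def by fastforce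
    then have "((\<lambda>s. b * \<rho> (\<kappa> * s) (a *\<^sub>R x)) has_real_derivative b * \<kappa> * d)
        (at t within {s. \<kappa> * s \<in> I})"
      using has_vector_derivative_rescale[where r = b]
      by (fastforce simp: has_real_derivative_iff_has_vector_derivative)
    moreover have "divergence (\<lambda>y. ?R y *\<^sub>R ?V y) x
        = b * \<kappa> * divergence (\<lambda>y. ?r y *\<^sub>R ?v y) (a *\<^sub>R x)"
      using divergence_rescale[OF \<open>open \<Omega>\<close> x flux_eq flux[OF x]] by (simp add: ca[symmetric] mult.assoc)
    ultimately show ?thesis
      using x d by (intro exI[of _ "b * \<kappa> * d"]) (simp flip: distrib_left)
  qed
  moreover have "\<exists>m. ((\<lambda>s. (b * \<rho> (\<kappa> * s) (a *\<^sub>R x)) *\<^sub>R (c *\<^sub>R u (\<kappa> * s) (a *\<^sub>R x)))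
          has_vector_derivative m)
        (at t within {s. (s, x) \<in> {(t, x). \<kappa> * t \<in> I \<and> a *\<^sub>R x \<in> \<Omega>}}) \<and>
      m + div_tensor (\<lambda>y. ?R y *\<^sub>R outer (?V y) (?V y)) x + grad (\<lambda>y. pressure A \<gamma> (?R y)) x
        = \<mu> *\<^sub>R vec_laplacian ?V x + (lam + \<mu>) *\<^sub>R grad (divergence ?V) x"
  proof -
    let ?z = "a *\<^sub>R x"
    obtain m where "((\<lambda>s. \<rho> s ?z *\<^sub>R u s ?z) has_vector_derivative m) (at (\<kappa> * t) within I)"
      and m: "m + div_tensor (\<lambda>y. ?r y *\<^sub>R outer (?v y) (?v y)) ?z
          + grad (\<lambda>y. pressure A \<gamma> (?r y)) ?z
        = \<mu> *\<^sub>R vec_laplacian ?v ?z + (lam + \<mu>) *\<^sub>R grad (divergence ?v) ?z"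
      using sol t x unfolding NS_solution_def by fastforce
    from has_vector_derivative_rescale[OF this(1), where r = "b * c"]
    have time: "((\<lambda>s. (b * \<rho> (\<kappa> * s) ?z) *\<^sub>R (c *\<^sub>R u (\<kappa> * s) ?z)) has_vector_derivative (a * \<kappa>) *\<^sub>R m)
        (at t within {s. \<kappa> * s \<in> I})"
      by (simp add: bc[symmetric] ac_simps)
    have "b * c * c * a = a * \<kappa>"
      using bc ca by (simp add: mult.assoc)
    then have tensor: "div_tensor (\<lambda>y. ?R y *\<^sub>R outer (?V y) (?V y)) x
        = (a * \<kappa>) *\<^sub>R div_tensor (\<lambda>y. ?r y *\<^sub>R outer (?v y) (?v y)) ?z"
      using div_tensor_rescale[OF \<open>open \<Omega>\<close> x convection_eq convection[OF x]] by simp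
    have pressure: "grad (\<lambda>y. pressure A \<gamma> (?R y)) x
        = (a * \<kappa>) *\<^sub>R grad (\<lambda>y. pressure A \<gamma> (?r y)) ?z"
      using grad_rescale[OF \<open>open \<Omega>\<close> x press_eq press[OF x]] by (simp add: mult.commute)
    have laplacian: "vec_laplacian ?V x = (a * \<kappa>) *\<^sub>R vec_laplacian ?v ?z"
      using vec_laplacian_rescale(2)[OF \<open>open \<Omega>\<close> x refl vel vel2[OF x], where k = c]
      unfolding ca by (simp add: mult.commute)
    have grad_div: "grad (divergence ?V) x = (a * \<kappa>) *\<^sub>R grad (divergence ?v) ?z"
      using grad_rescale[OF \<open>open \<Omega>\<close> x div_eq divv[OF x]] by (simp add: mult.commute)
    have "(a * \<kappa>) *\<^sub>R m + div_tensor (\<lambda>y. ?R y *\<^sub>R outer (?V y) (?V y)) x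
        + grad (\<lambda>y. pressure A \<gamma> (?R y)) x
      = \<mu> *\<^sub>R vec_laplacian ?V x + (lam + \<mu>) *\<^sub>R grad (divergence ?V) x"
      using arg_cong[OF m, of "(*\<^sub>R) (a * \<kappa>)"]
      unfolding tensor pressure laplacian grad_div
      by (simp only: scaleR_add_right scaleR_left_commute)
    then show ?thesis
      using time x by (intro exI[of _ "(a * \<kappa>) *\<^sub>R m"]) simp
  qed
  ultimately show "?R x \<ge> 0 \<and> spatial_derivs_exist A \<gamma> ?R ?V x \<and>
      (\<exists>d. ((\<lambda>s. b * \<rho> (\<kappa> * s) (a *\<^sub>R x)) has_real_derivative d)
        (at t within {s. (s, x) \<in> {(t, x). \<kappa> * t \<in> I \<and> a *\<^sub>R x \<in> \<Omega>}}) \<and>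
        d + divergence (\<lambda>y. ?R y *\<^sub>R ?V y) x = 0) \<and>
      (\<exists>m. ((\<lambda>s. (b * \<rho> (\<kappa> * s) (a *\<^sub>R x)) *\<^sub>R (c *\<^sub>R u (\<kappa> * s) (a *\<^sub>R x)))
          has_vector_derivative m)
        (at t within {s. (s, x) \<in> {(t, x). \<kappa> * t \<in> I \<and> a *\<^sub>R x \<in> \<Omega>}}) \<and>
      m + div_tensor (\<lambda>y. ?R y *\<^sub>R outer (?V y) (?V y)) x + grad (\<lambda>y. pressure A \<gamma> (?R y)) x
        = \<mu> *\<^sub>R vec_laplacian ?V x + (lam + \<mu>) *\<^sub>R grad (divergence ?V) x)"
    by blast
qed

theorem theorem1p1:
  fixes A \<gamma> \<mu> lam :: real
    and \<Omega> :: "(real^'n::finite) set"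
    and I :: "real set"
    and \<rho> :: "real \<Rightarrow> real^'n \<Rightarrow> real"
    and u :: "real \<Rightarrow> real^'n \<Rightarrow> real^'n"
  assumes "CARD('n) \<in> {2, 3}"
    and "A > 0" and "\<gamma> \<ge> 1"
    and "\<mu> > 0" and "real CARD('n) * lam + 2 * \<mu> > 0"
    and "smooth_bounded_domain \<Omega> \<or> \<Omega> = UNIV"
    and "is_interval I" and "I \<subseteq> {0..}"
    and "NS_solution A \<gamma> \<mu> lam (I \<times> \<Omega>) \<rho> u"
  shows "\<forall>\<kappa>>0. NS_solution A \<gamma> \<mu> lam
           {(t, x). \<kappa> * t \<in> I \<and> \<kappa> powr ((\<gamma> + 1) / (2 * \<gamma>)) *\<^sub>R x \<in> \<Omega>}
           (rescaled_density \<gamma> \<kappa> \<rho>) (rescaled_velocity \<gamma> \<kappa> u)"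
proof (intro allI impI)
  fix \<kappa> :: real
  assume "\<kappa> > 0"
  have "open \<Omega>"
    using assms(6) by (auto simp: smooth_bounded_domain_def)
  have velocity_space: "(\<gamma> - 1) / (2 * \<gamma>) + (\<gamma> + 1) / (2 * \<gamma>) = 1"
    and density_velocity: "1 / \<gamma> + (\<gamma> - 1) / (2 * \<gamma>) = (\<gamma> + 1) / (2 * \<gamma>)"
    and density: "1 / \<gamma> * \<gamma> = 1"
    using \<open>\<gamma> \<ge> 1\<close> by (simp_all add: field_simps)
  show "NS_solution A \<gamma> \<mu> lam
      {(t, x). \<kappa> * t \<in> I \<and> \<kappa> powr ((\<gamma> + 1) / (2 * \<gamma>)) *\<^sub>R x \<in> \<Omega>}
      (rescaled_density \<gamma> \<kappa> \<rho>) (rescaled_velocity \<gamma> \<kappa> u)"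
    unfolding rescaled_density_def[abs_def] rescaled_velocity_def[abs_def]
  proof (rule NS_solution_rescale[OF \<open>open \<Omega>\<close> assms(9)])
    show "\<kappa> powr ((\<gamma> - 1) / (2 * \<gamma>)) * \<kappa> powr ((\<gamma> + 1) / (2 * \<gamma>)) = \<kappa>"
      using \<open>\<kappa> > 0\<close> by (simp only: powr_add[symmetric] velocity_space powr_one)
    show "\<kappa> powr (1 / \<gamma>) * \<kappa> powr ((\<gamma> - 1) / (2 * \<gamma>)) = \<kappa> powr ((\<gamma> + 1) / (2 * \<gamma>))"
      by (simp only: powr_add[symmetric] density_velocity)
    show "(\<kappa> powr (1 / \<gamma>)) powr \<gamma> = \<kappa>"
      using \<open>\<kappa> > 0\<close> by (simp only: powr_powr density powr_one)
  qed simp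
qed

end
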